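(* Consider an explicit point stage $$w_\sigma^{n+1}=w_\sigma^n+\Delta t\,\bigl(\mathcal D^{\mathrm{pt}}(u_h^n)\bigr)_\sigma,\qquad u_\sigma^{n+1}=\mathcal B(w_\sigma^{n+1}),\qquad\sigma\in\Sigma_h,$$ where $\mathcal B:\mathbb R^m\to G_{\mathrm{pt}}$ is a globally defined map with prescribed range $G_{\mathrm{pt}}$ and $\mathcal D^{\mathrm{pt}}$ is the point operator of the context. Assume either (E) the exact smooth setting: $\Psi:\mathring G\to\mathbb R^m$ is an admissibility transform (see context), the boundary conditions supply the required exterior traces and boundary directional derivatives, the current point states lie in $\mathring G$, $w_\sigma^n=\Psi(u_\sigma^n)$, $\mathcal B=\Psi^{-1}$ and $G_{\mathrm{pt}}=\mathring G$; or (P) a practical forward map $\mathcal T$ and admissibility-preserving map $\mathcal B$ for which the directional derivatives entering $\mathcal D^{\mathrm{pt}}$ are well-defined at the current point states, the values $w_\sigma^{n+1}$ are finite, and the range of $\mathcal B$ is contained in $G_{\mathrm{pt}}$. Then in case (E) the point operator is well-defined at every $\sigma\in\Sigma_h$. Moreover, in both cases $w_\sigma^{n+1}\in\mathbb R^m$ and $u_\sigma^{n+1}\in G_{\mathrm{pt}}$ for all $\sigma\in\Sigma_h$.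
   Context: PDE: $\partial_tu+\sum_{i=1}^2\partial_{x_i}f_i(u)=0$, hyperbolic, $u\in\mathbb R^m$, $A_i=Df_i$. $\mathring G\subset\mathbb R^m$ is the open admissible interior. Admissibility transform: $\Psi:\mathring G\to\mathbb R^m$ is bijective, $C^1$ with $D\Psi(u)$ invertible for all $u\in\mathring G$; $\Psi,\Psi^{-1}$ are locally Lipschitz; for smooth solutions $u\in\mathring G$ the variable $w=\Psi(u)$ satisfies $\partial_tw+\sum_iJ_i(u)\partial_{x_i}w=0$, $J_i=D\Psi A_i(D\Psi)^{-1}$. In case (P), $\Psi$ is replaced below by a forward map $\mathcal T:U_{\mathrm{fwd}}\to\mathbb R^m$ differentiable at the current point states. Mesh and data: $\mathcal T_h$ is a conforming mesh of open convex polygons $K$ of $\Omega\subseteq\mathbb R^2$; $\Sigma_h$ is a finite set of nodes $\sigma$ (vertices and edge midpoints) with coordinates $x_\sigma$; $u_h=((\bar u_K)_K,(u_\sigma)_\sigma)$; the reconstruction $u_K=\mathcal R_K(u_h)$ in a finite-dimensional space of functions differentiable up to $\partial K$ has cell average $\bar u_K$ and $u_K(x_\sigma)=u_\sigma$ for $x_\sigma\in\partial K$. Point operator: $J_q=\sum_iq_iJ_i$, $\partial_qw_{K,\sigma}:=D\Psi(u_\sigma)(q\cdot\nabla u_K(x_\sigma))$. Let $\mathcal E_\sigma$ be the edges containing $x_\sigma$; for $e\in\mathcal E_\sigma$, $\tau_{\sigma,e}$ is the unit tangent of $e$ oriented away from $x_\sigma$, $n_{\sigma,e}$ the unit normal such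 that $(n_{\sigma,e},\tau_{\sigma,e})$ is a right-handed orthonormal basis, pointing from cell $K^-_{\sigma,e}$ to cell $K^+_{\sigma,e}$. For a vertex, $K^{\mathrm{ext}}_{\sigma,e}$ is the cell containing $x_\sigma-\varepsilon\tau_{\sigma,e}$ for small $\varepsilon>0$ (ties broken deterministically). With $\theta_{K,\sigma}$ the interior angle of $K$ at $\sigma$, $\theta_{\sigma,e}=\frac12(\theta_{K^-_{\sigma,e},\sigma}+\theta_{K^+_{\sigma,e},\sigma})$ (only $\frac12\theta_{K^-_{\sigma,e},\sigma}$ on a boundary edge), $\omega_{\sigma,e}=\theta_{\sigma,e}/\sum_{e'\in\mathcal E_\sigma}\theta_{\sigma,e'}$. $\alpha_\sigma>0$ is not less than the spectral radii of $J_{n_{\sigma,e}}(u_\sigma),J_{\tau_{\sigma,e}}(u_\sigma)$, $e\in\mathcal E_\sigma$; $J_q^\pm=\frac12(J_q(u_\sigma)\pm\alpha_\sigma I)$. For a vertex, $$(\mathcal D^{\mathrm{pt}}(u_h))_\sigma=-\sum_{e\in\mathcal E_\sigma}\omega_{\sigma,e}\bigl(J^+_{n_{\sigma,e}}\partial_{n_{\sigma,e}}w_{K^-_{\sigma,e},\sigma}+J^-_{n_{\sigma,e}}\partial_{n_{\sigma,e}}w_{K^+_{\sigma,e},\sigma}+J^-_{\tau_{\sigma,e}}\partial_{\tau_{\sigma,e}}w_{K^-_{\sigma,e},\sigma}+J^+_{\tau_{\sigma,e}}\partial_{\tau_{\sigma,e}}w_{K^{\mathrm{ext}}_{\sigma,e},\sigma}\bigr);$$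 for the midpoint of $e$, $$(\mathcal D^{\mathrm{pt}}(u_h))_\sigma=-\bigl(J^+_{n_{\sigma,e}}\partial_{n_{\sigma,e}}w_{K^-_{\sigma,e},\sigma}+J^-_{n_{\sigma,e}}\partial_{n_{\sigma,e}}w_{K^+_{\sigma,e},\sigma}+J_{\tau_{\sigma,e}}\partial_{\tau_{\sigma,e}}w_{K^-_{\sigma,e},\sigma}\bigr).$$ At the boundary, missing exterior traces and directional derivatives are finite data supplied by the boundary conditions. *)

theory Defs
  imports "HOL-Analysis.Analysis" "HOL-Library.Monad_Syntax"
begin

text \<open>Quantities that may fail to exist are modelled by type \<open>option\<close>: \<open>None\<close> means
  "not defined", \<open>Some\<close> carries a (finite) real vector or matrix.\<close>

section \<open>Derivatives and matrices\<close>

text \<open>Derivative of a function whose domain is \<open>D\<close>. It is defined only if it is unique; for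
  \<open>D\<close> open this is the usual Frechet derivative, and for \<open>D\<close> the closure of a mesh cell it is
  the derivative up to the boundary.\<close>

definition rel_deriv ::
  "'a::real_normed_vector set \<Rightarrow> ('a \<Rightarrow> 'b::real_normed_vector) \<Rightarrow> 'a \<Rightarrow> ('a \<Rightarrow> 'b) option" where
  "rel_deriv D g x =
     (if x \<in> D \<and> (\<exists>!g'. (g has_derivative g') (at x within D))
      then Some (THE g'. (g has_derivative g') (at x within D)) else None)"

definition complex_spectrum :: "real^'m^'m \<Rightarrow> complex set" where
  "complex_spectrum M =
     {l. \<exists>v::complex^'m. v \<noteq> 0 \<and> (\<chi> i j. complex_of_real (M $ i $ j)) *v v = l *s v}"

definition spec_radius :: "real^'m^'m \<Rightarrow> real" where
  "spec_radius M = Max (cmod ` complex_spectrum M)"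

definition real_diagonalizable :: "real^'m^'m \<Rightarrow> bool" where
  "real_diagonalizable M \<longleftrightarrow>
     (\<exists>(P::real^'m^'m) d. invertible P \<and> M ** P = P ** (\<chi> i j. if i = j then d $ i else 0))"

section \<open>The PDE and admissibility transforms\<close>

definition hyperbolic_on :: "(real^'m) set \<Rightarrow> (2 \<Rightarrow> real^'m \<Rightarrow> real^'m) \<Rightarrow> bool" where
  "hyperbolic_on G f \<longleftrightarrow>
     (\<forall>u\<in>G. \<exists>A::2 \<Rightarrow> real^'m^'m.
        (\<forall>i. (f i has_derivative (*v) (A i)) (at u)) \<and>
        (\<forall>q::real^2. real_diagonalizable (\<Sum>i\<in>UNIV. q $ i *\<^sub>R A i)))"

text \<open>\<open>J\<^sub>i(u) = D\<Phi>(u) A\<^sub>i(u) D\<Phi>(u)\<^sup>-\<^sup>1\<close> for a transform \<open>\<Phi>\<close> with domain \<open>D\<close>.\<close>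

definition transformed_jacobian ::
  "(real^'m) set \<Rightarrow> (real^'m \<Rightarrow> real^'m) \<Rightarrow> (2 \<Rightarrow> real^'m \<Rightarrow> real^'m) \<Rightarrow> 2 \<Rightarrow> real^'m
    \<Rightarrow> (real^'m^'m) option" where
  "transformed_jacobian D \<Phi> f i u =
     do { P \<leftarrow> rel_deriv D \<Phi> u;
          A \<leftarrow> rel_deriv UNIV (f i) u;
          if invertible (matrix P)
          then Some (matrix P ** matrix A ** matrix_inv (matrix P))
          else None }"

definition dt_of :: "(real \<times> (real^2) \<Rightarrow> real^'m) \<Rightarrow> real \<Rightarrow> real^2 \<Rightarrow> real^'m" where
  "dt_of v t x = vector_derivative (\<lambda>s. v (s, x)) (at t)"

definition dx_of :: "2 \<Rightarrow> (real \<times> (real^2) \<Rightarrow> real^'m) \<Rightarrow> real \<Rightarrow> real^2 \<Rightarrow> real^'m" where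
  "dx_of i v t x = vector_derivative (\<lambda>s. v (t, x + s *\<^sub>R axis i 1)) (at 0)"

definition smooth_solution ::
  "(real^'m) set \<Rightarrow> (2 \<Rightarrow> real^'m \<Rightarrow> real^'m) \<Rightarrow> (real \<times> (real^2)) set \<Rightarrow> (real \<times> (real^2) \<Rightarrow> real^'m)
    \<Rightarrow> bool" where
  "smooth_solution G f Q u \<longleftrightarrow>
     open Q \<and> u ` Q \<subseteq> G \<and>
     (\<exists>u' :: real \<times> (real^2) \<Rightarrow> (real \<times> (real^2)) \<Rightarrow>\<^sub>L (real^'m).
        (\<forall>p\<in>Q. (u has_derivative blinfun_apply (u' p)) (at p)) \<and> continuous_on Q u') \<and>
     (\<forall>(t, x)\<in>Q. dt_of u t x + (\<Sum>i\<in>UNIV. dx_of i (f i \<circ> u) t x) = 0)"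

text \<open>The library's \<open>local_lipschitz\<close> is for time-dependent maps; the time set is a singleton.\<close>

definition admissibility_transform ::
  "(real^'m) set \<Rightarrow> (2 \<Rightarrow> real^'m \<Rightarrow> real^'m) \<Rightarrow> (real^'m \<Rightarrow> real^'m) \<Rightarrow> bool" where
  "admissibility_transform G f \<Psi> \<longleftrightarrow>
     bij_betw \<Psi> G UNIV \<and>
     (\<exists>\<Psi>' :: real^'m \<Rightarrow> real^'m^'m.
        (\<forall>u\<in>G. (\<Psi> has_derivative (*v) (\<Psi>' u)) (at u) \<and> invertible (\<Psi>' u)) \<and>
        continuous_on G \<Psi>') \<and>
     local_lipschitz {0::real} G (\<lambda>_. \<Psi>) \<and>
     local_lipschitz {0::real} UNIV (\<lambda>_. inv_into G \<Psi>) \<and>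
     (\<forall>Q u. smooth_solution G f Q u \<longrightarrow>
        (\<forall>(t, x)\<in>Q. \<forall>J. (\<forall>i. transformed_jacobian G \<Psi> f i (u (t, x)) = Some (J i)) \<longrightarrow>
           dt_of (\<Psi> \<circ> u) t x + (\<Sum>i\<in>UNIV. J i *v dx_of i (\<Psi> \<circ> u) t x) = 0))"

section \<open>Mesh geometry\<close>

definition open_convex_polygon :: "(real^2) set \<Rightarrow> bool" where
  "open_convex_polygon K \<longleftrightarrow> open K \<and> K \<noteq> {} \<and> convex K \<and> polytope (closure K)"

definition conforming_mesh :: "(real^2) set \<Rightarrow> (real^2) set set \<Rightarrow> bool" where
  "conforming_mesh \<Omega> \<T> \<longleftrightarrow>
     finite \<T> \<and> (\<forall>K\<in>\<T>. open_convex_polygon K) \<and> pairwise disjnt \<T> \<and>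
     \<Union>\<T> \<subseteq> \<Omega> \<and> closure \<Omega> = (\<Union>K\<in>\<T>. closure K) \<and>
     (\<forall>K\<in>\<T>. \<forall>L\<in>\<T>. K \<noteq> L \<longrightarrow>
        (closure K \<inter> closure L) face_of closure K \<and> (closure K \<inter> closure L) face_of closure L)"

definition mesh_vertices :: "(real^2) set set \<Rightarrow> (real^2) set" where
  "mesh_vertices \<T> = {v. \<exists>K\<in>\<T>. v extreme_point_of closure K}"

text \<open>Edges are closed segments.\<close>

definition mesh_edges :: "(real^2) set set \<Rightarrow> (real^2) set set" where
  "mesh_edges \<T> = {e. \<exists>K\<in>\<T>. e edge_of closure K}"

datatype node = Vertex "real^2" | Midpoint "(real^2) set"

fun coord :: "node \<Rightarrow> real^2" where
  "coord (Vertex v) = v"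
| "coord (Midpoint e) = (THE x. \<exists>a b. e = closed_segment a b \<and> x = midpoint a b)"

text \<open>At a vertex this determines \<open>t\<close>; at a midpoint both orientations point away from \<open>x\<close>.\<close>

definition unit_tangent_from :: "real^2 \<Rightarrow> (real^2) set \<Rightarrow> real^2 \<Rightarrow> bool" where
  "unit_tangent_from x e t \<longleftrightarrow> norm t = 1 \<and> (\<forall>\<^sub>F \<epsilon> in at_right 0. x + \<epsilon> *\<^sub>R t \<in> e)"

text \<open>The vector \<open>n\<close> for which \<open>(n, t)\<close> is a right-handed orthonormal basis.\<close>

definition right_normal :: "real^2 \<Rightarrow> real^2" where
  "right_normal t = vector [t $ 2, - (t $ 1)]"

definition interior_angle :: "(real^2) set \<Rightarrow> real^2 \<Rightarrow> real" where
  "interior_angle K x =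
     (THE \<theta>. \<exists>e1 e2 t1 t2. e1 edge_of closure K \<and> e2 edge_of closure K \<and> e1 \<noteq> e2 \<and>
        unit_tangent_from x e1 t1 \<and> unit_tangent_from x e2 t2 \<and> x \<in> e1 \<and> x \<in> e2 \<and>
        \<theta> = arccos (t1 \<bullet> t2))"

section \<open>The discretisation\<close>

datatype side = Minus | Plus | Ext

type_synonym 'm dofs = "((real^2) set \<Rightarrow> real^'m) \<times> (node \<Rightarrow> real^'m)"

text \<open>\<open>fwd\<close> is the transform entering the point operator, with domain \<open>fwd_dom\<close>: \<open>\<Psi>\<close> on
  the admissible interior, or a practical forward map. \<open>ext_choice\<close> is the upwind cell
  \<open>K\<^sup>e\<^sup>x\<^sup>t\<close> including the rule that breaks ties. \<open>bdry \<sigma> e s q\<close> is the value that the boundary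
  conditions supply for \<open>\<partial>\<^sub>q w\<close> when the cell on side \<open>s\<close> does not exist.\<close>

record 'm scheme =
  flux :: "2 \<Rightarrow> real^'m \<Rightarrow> real^'m"
  fwd_dom :: "(real^'m) set"
  fwd :: "real^'m \<Rightarrow> real^'m"
  cells :: "(real^2) set set"
  nodes :: "node set"
  recon_space :: "(real^2) set \<Rightarrow> (real^2 \<Rightarrow> real^'m) set"
  recon :: "(real^2) set \<Rightarrow> 'm dofs \<Rightarrow> real^2 \<Rightarrow> real^'m"
  dofs :: "'m dofs"
  tangent :: "node \<Rightarrow> (real^2) set \<Rightarrow> real^2"
  ext_choice :: "node \<Rightarrow> (real^2) set \<Rightarrow> (real^2) set option"
  speed :: "node \<Rightarrow> real"
  bdry :: "node \<Rightarrow> (real^2) set \<Rightarrow> side \<Rightarrow> real^2 \<Rightarrow> (real^'m) option"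

definition pt_state :: "('m::finite) scheme \<Rightarrow> node \<Rightarrow> real^'m" where
  "pt_state S \<sigma> = snd (dofs S) \<sigma>"

definition cell_fun :: "('m::finite) scheme \<Rightarrow> (real^2) set \<Rightarrow> real^2 \<Rightarrow> real^'m" where
  "cell_fun S K = recon S K (dofs S)"

definition edges_at :: "('m::finite) scheme \<Rightarrow> node \<Rightarrow> (real^2) set set" where
  "edges_at S \<sigma> = {e \<in> mesh_edges (cells S). coord \<sigma> \<in> e}"

definition normal :: "('m::finite) scheme \<Rightarrow> node \<Rightarrow> (real^2) set \<Rightarrow> real^2" where
  "normal S \<sigma> e = right_normal (tangent S \<sigma> e)"

text \<open>Closed cells are used so that there is a candidate also when \<open>x - \<epsilon>\<tau>\<close> runs along an edge;
  this is the case in which ties occur.\<close>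

definition ext_candidates :: "('m::finite) scheme \<Rightarrow> node \<Rightarrow> (real^2) set \<Rightarrow> (real^2) set set" where
  "ext_candidates S \<sigma> e =
     {K \<in> cells S. \<forall>\<^sub>F \<epsilon> in at_right 0. coord \<sigma> - \<epsilon> *\<^sub>R tangent S \<sigma> e \<in> closure K}"

definition the_cell :: "(real^2) set set \<Rightarrow> (real^2) set option" where
  "the_cell X = (if X = {} then None else Some (THE K. K \<in> X))"

text \<open>The cells \<open>K\<^sup>-\<close>, \<open>K\<^sup>+\<close> and \<open>K\<^sup>e\<^sup>x\<^sup>t\<close>; \<open>None\<close> if the cell lies outside the domain.\<close>

fun cell_at :: "('m::finite) scheme \<Rightarrow> node \<Rightarrow> (real^2) set \<Rightarrow> side \<Rightarrow> (real^2) set option" where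
  "cell_at S \<sigma> e Minus =
     the_cell {K \<in> cells S. e edge_of closure K \<and> (\<forall>y\<in>K. normal S \<sigma> e \<bullet> (y - coord \<sigma>) < 0)}"
| "cell_at S \<sigma> e Plus =
     the_cell {K \<in> cells S. e edge_of closure K \<and> (\<forall>y\<in>K. normal S \<sigma> e \<bullet> (y - coord \<sigma>) > 0)}"
| "cell_at S \<sigma> e Ext = ext_choice S \<sigma> e"

text \<open>On a boundary edge only the existing adjacent cell contributes.\<close>

definition edge_angle :: "('m::finite) scheme \<Rightarrow> node \<Rightarrow> (real^2) set \<Rightarrow> real" where
  "edge_angle S \<sigma> e =
     1/2 * (\<Sum>s\<in>{Minus, Plus}. case cell_at S \<sigma> e s of None \<Rightarrow> 0
                                | Some K \<Rightarrow> interior_angle K (coord \<sigma>))"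

definition edge_weight :: "('m::finite) scheme \<Rightarrow> node \<Rightarrow> (real^2) set \<Rightarrow> real option" where
  "edge_weight S \<sigma> e =
     (let total = (\<Sum>e'\<in>edges_at S \<sigma>. edge_angle S \<sigma> e')
      in if total = 0 then None else Some (edge_angle S \<sigma> e / total))"

section \<open>The point operator\<close>

definition J_dir :: "('m::finite) scheme \<Rightarrow> node \<Rightarrow> real^2 \<Rightarrow> (real^'m^'m) option" where
  "J_dir S \<sigma> q =
     do { J1 \<leftarrow> transformed_jacobian (fwd_dom S) (fwd S) (flux S) 1 (pt_state S \<sigma>);
          J2 \<leftarrow> transformed_jacobian (fwd_dom S) (fwd S) (flux S) 2 (pt_state S \<sigma>);
          Some (q $ 1 *\<^sub>R J1 + q $ 2 *\<^sub>R J2) }"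

definition J_plus :: "('m::finite) scheme \<Rightarrow> node \<Rightarrow> real^2 \<Rightarrow> (real^'m^'m) option" where
  "J_plus S \<sigma> q = do { J \<leftarrow> J_dir S \<sigma> q; Some ((1/2) *\<^sub>R (J + mat (speed S \<sigma>))) }"

definition J_minus :: "('m::finite) scheme \<Rightarrow> node \<Rightarrow> real^2 \<Rightarrow> (real^'m^'m) option" where
  "J_minus S \<sigma> q = do { J \<leftarrow> J_dir S \<sigma> q; Some ((1/2) *\<^sub>R (J - mat (speed S \<sigma>))) }"

definition dir_deriv ::
  "('m::finite) scheme \<Rightarrow> node \<Rightarrow> (real^2) set \<Rightarrow> side \<Rightarrow> real^2 \<Rightarrow> (real^'m) option" where
  "dir_deriv S \<sigma> e s q =
     (case cell_at S \<sigma> e s of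
        None \<Rightarrow> bdry S \<sigma> e s q
      | Some K \<Rightarrow>
          do { P \<leftarrow> rel_deriv (fwd_dom S) (fwd S) (pt_state S \<sigma>);
               d \<leftarrow> rel_deriv (closure K) (cell_fun S K) (coord \<sigma>);
               Some (P (d q)) })"

definition opt_mult :: "(real^'m^'m) option \<Rightarrow> (real^'m) option \<Rightarrow> (real^'m) option" where
  "opt_mult M v = do { A \<leftarrow> M; b \<leftarrow> v; Some (A *v b) }"

definition opt_add :: "(real^'m) option \<Rightarrow> (real^'m) option \<Rightarrow> (real^'m) option" where
  "opt_add v w = do { a \<leftarrow> v; b \<leftarrow> w; Some (a + b) }"

definition opt_sum :: "'a set \<Rightarrow> ('a \<Rightarrow> (real^'m) option) \<Rightarrow> (real^'m) option" where
  "opt_sum X g =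
     (if finite X \<and> (\<forall>x\<in>X. g x \<noteq> None) then Some (\<Sum>x\<in>X. the (g x)) else None)"

definition normal_part :: "('m::finite) scheme \<Rightarrow> node \<Rightarrow> (real^2) set \<Rightarrow> (real^'m) option" where
  "normal_part S \<sigma> e =
     (let n = normal S \<sigma> e in
      opt_add (opt_mult (J_plus S \<sigma> n) (dir_deriv S \<sigma> e Minus n))
              (opt_mult (J_minus S \<sigma> n) (dir_deriv S \<sigma> e Plus n)))"

definition vertex_tangential_part ::
  "('m::finite) scheme \<Rightarrow> node \<Rightarrow> (real^2) set \<Rightarrow> (real^'m) option" where
  "vertex_tangential_part S \<sigma> e =
     (let \<tau> = tangent S \<sigma> e in
      opt_add (opt_mult (J_minus S \<sigma> \<tau>) (dir_deriv S \<sigma> e Minus \<tau>))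
              (opt_mult (J_plus S \<sigma> \<tau>) (dir_deriv S \<sigma> e Ext \<tau>)))"

definition midpoint_tangential_part ::
  "('m::finite) scheme \<Rightarrow> node \<Rightarrow> (real^2) set \<Rightarrow> (real^'m) option" where
  "midpoint_tangential_part S \<sigma> e =
     (let \<tau> = tangent S \<sigma> e in opt_mult (J_dir S \<sigma> \<tau>) (dir_deriv S \<sigma> e Minus \<tau>))"

fun point_op :: "('m::finite) scheme \<Rightarrow> node \<Rightarrow> (real^'m) option" where
  "point_op S (Vertex v) =
     (let \<sigma> = Vertex v in
      map_option uminus (opt_sum (edges_at S \<sigma>) (\<lambda>e.
        do { \<omega> \<leftarrow> edge_weight S \<sigma> e;
             r \<leftarrow> opt_add (normal_part S \<sigma> e) (vertex_tangential_part S \<sigma> e);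
             Some (\<omega> *\<^sub>R r) })))"
| "point_op S (Midpoint e) =
     (let \<sigma> = Midpoint e in
      map_option uminus (opt_add (normal_part S \<sigma> e) (midpoint_tangential_part S \<sigma> e)))"

text \<open>The triples \<open>(e, s, q)\<close> whose directional derivative enters the operator at the node.\<close>

fun stencil :: "('m::finite) scheme \<Rightarrow> node \<Rightarrow> ((real^2) set \<times> side \<times> (real^2)) set" where
  "stencil S (Vertex v) =
     (let \<sigma> = Vertex v in \<Union>e\<in>edges_at S \<sigma>.
        {(e, Minus, normal S \<sigma> e), (e, Plus, normal S \<sigma> e),
         (e, Minus, tangent S \<sigma> e), (e, Ext, tangent S \<sigma> e)})"
| "stencil S (Midpoint e) =
     (let \<sigma> = Midpoint e in
        {(e, Minus, normal S \<sigma> e), (e, Plus, normal S \<sigma> e), (e, Minus, tangent S \<sigma> e)})"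

section \<open>Standing assumptions and the point stage\<close>

definition finite_dim_space :: "(real^2 \<Rightarrow> real^'m) set \<Rightarrow> bool" where
  "finite_dim_space V \<longleftrightarrow>
     (\<exists>B. finite B \<and> V = {v. \<exists>c. v = (\<lambda>x. \<Sum>b\<in>B. c b *\<^sub>R b x)})"

definition valid_nodes :: "('m::finite) scheme \<Rightarrow> bool" where
  "valid_nodes S \<longleftrightarrow>
     finite (nodes S) \<and>
     nodes S \<subseteq> Vertex ` mesh_vertices (cells S) \<union> Midpoint ` mesh_edges (cells S)"

definition valid_reconstruction :: "('m::finite) scheme \<Rightarrow> bool" where
  "valid_reconstruction S \<longleftrightarrow>
     (\<forall>K\<in>cells S.
        finite_dim_space (recon_space S K) \<and>
        (\<forall>v\<in>recon_space S K. v differentiable_on closure K) \<and>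
        cell_fun S K \<in> recon_space S K \<and>
        (1 / measure lebesgue K) *\<^sub>R integral K (cell_fun S K) = fst (dofs S) K \<and>
        (\<forall>\<sigma>\<in>nodes S. coord \<sigma> \<in> frontier K \<longrightarrow> cell_fun S K (coord \<sigma>) = pt_state S \<sigma>))"

definition valid_orientation :: "('m::finite) scheme \<Rightarrow> bool" where
  "valid_orientation S \<longleftrightarrow>
     (\<forall>\<sigma>\<in>nodes S. \<forall>e\<in>edges_at S \<sigma>. unit_tangent_from (coord \<sigma>) e (tangent S \<sigma> e)) \<and>
     (\<forall>v. Vertex v \<in> nodes S \<longrightarrow> (\<forall>e\<in>edges_at S (Vertex v).
        (case ext_choice S (Vertex v) e of
           None \<Rightarrow> ext_candidates S (Vertex v) e = {}
         | Some K \<Rightarrow> K \<in> ext_candidates S (Vertex v) e)))"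

definition valid_speeds :: "('m::finite) scheme \<Rightarrow> bool" where
  "valid_speeds S \<longleftrightarrow>
     (\<forall>\<sigma>\<in>nodes S. speed S \<sigma> > 0 \<and>
        (\<forall>e\<in>edges_at S \<sigma>. \<forall>q\<in>{normal S \<sigma> e, tangent S \<sigma> e}. \<forall>J.
           J_dir S \<sigma> q = Some J \<longrightarrow> spec_radius J \<le> speed S \<sigma>))"

definition boundary_data_supplied :: "('m::finite) scheme \<Rightarrow> bool" where
  "boundary_data_supplied S \<longleftrightarrow>
     (\<forall>\<sigma>\<in>nodes S. \<forall>(e, s, q)\<in>stencil S \<sigma>.
        cell_at S \<sigma> e s = None \<longrightarrow> bdry S \<sigma> e s q \<noteq> None)"

definition w_next ::
  "('m::finite) scheme \<Rightarrow> real \<Rightarrow> (node \<Rightarrow> real^'m) \<Rightarrow> node \<Rightarrow> (real^'m) option" where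
  "w_next S \<Delta>t w \<sigma> = do { d \<leftarrow> point_op S \<sigma>; Some (w \<sigma> + \<Delta>t *\<^sub>R d) }"

definition u_next ::
  "('m::finite) scheme \<Rightarrow> (real^'m \<Rightarrow> real^'m) \<Rightarrow> real \<Rightarrow> (node \<Rightarrow> real^'m) \<Rightarrow> node
    \<Rightarrow> (real^'m) option" where
  "u_next S \<B> \<Delta>t w \<sigma> = map_option \<B> (w_next S \<Delta>t w \<sigma>)"

definition exact_setting ::
  "('m::finite) scheme \<Rightarrow> (real^'m) set \<Rightarrow> (real^'m \<Rightarrow> real^'m) \<Rightarrow> (real^'m) set
    \<Rightarrow> (node \<Rightarrow> real^'m) \<Rightarrow> bool" where
  "exact_setting S G \<B> Gpt w \<longleftrightarrow>
     fwd_dom S = G \<and> admissibility_transform G (flux S) (fwd S) \<and>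
     boundary_data_supplied S \<and>
     (\<forall>\<sigma>\<in>nodes S. pt_state S \<sigma> \<in> G \<and> w \<sigma> = fwd S (pt_state S \<sigma>)) \<and>
     \<B> = inv_into G (fwd S) \<and> Gpt = G"

definition practical_setting ::
  "('m::finite) scheme \<Rightarrow> (real^'m \<Rightarrow> real^'m) \<Rightarrow> (real^'m) set \<Rightarrow> real \<Rightarrow> (node \<Rightarrow> real^'m)
    \<Rightarrow> bool" where
  "practical_setting S \<B> Gpt \<Delta>t w \<longleftrightarrow>
     (\<forall>\<sigma>\<in>nodes S. rel_deriv (fwd_dom S) (fwd S) (pt_state S \<sigma>) \<noteq> None) \<and>
     (\<forall>\<sigma>\<in>nodes S. \<forall>(e, s, q)\<in>stencil S \<sigma>. dir_deriv S \<sigma> e s q \<noteq> None) \<and>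
     (\<forall>\<sigma>\<in>nodes S. w_next S \<Delta>t w \<sigma> \<noteq> None) \<and>
     range \<B> \<subseteq> Gpt"

end

theory Submission
  imports Defs
begin

text \<open>The range of \<open>\<B>\<close> lies in \<open>G\<^sub>p\<^sub>t\<close> in both settings: by hypothesis in the practical one, and
  because \<open>\<Psi>\<^sup>-\<^sup>1\<close> maps all of \<open>\<real>\<^sup>m\<close> back into the admissible interior in the exact one. So the
  updated point state is admissible as soon as the updated \<open>w\<close> exists, and all the work is to show
  that in the exact setting every ingredient of the point operator exists. Three things could fail.

  \<^item> The Jacobians and directional derivatives. At an admissible state the derivatives of \<open>\<Psi>\<close> and of
  the fluxes exist on an open set, and \<open>D\<Psi>\<close> is invertible. The reconstruction is differentiable only
  up to the boundary of a cell, so its gradient at a node has to be shown to be unique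
  (\<open>convex_body_derivative_unique\<close>); this holds because the cell is convex with interior points.

  \<^item> The choice of the cells \<open>K\<^sup>-\<close> and \<open>K\<^sup>+\<close>. It is determined because two cells that share an edge and
  lie on the same side of it would overlap (\<open>same_side_cells_meet\<close>).

  \<^item> The weights \<open>\<omega>\<close>, which divide by the sum of the angles at a vertex. The angles are well-defined and
  positive because a mesh vertex is an extreme point of every cell that touches it
  (\<open>mesh_vertex_extreme\<close>) and exactly two edges of a polygon meet at such a point
  (\<open>at_least_two_edges\<close>, \<open>at_most_two_edges\<close>), not parallel to each other
  (\<open>distinct_edges_transversal\<close>).\<close>

section \<open>Derivatives up to the boundary\<close>

lemma rel_deriv_open:
  assumes "open D" "x \<in> D" "(g has_derivative g') (at x)"
  shows "rel_deriv D g x = Some g'"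
proof -
  have within: "at x within D = at x"
    using assms(2,1) by (rule at_within_open)
  have unique: "h = g'" if "(g has_derivative h) (at x)" for h
    using that assms(3) by (rule has_derivative_unique)
  from assms(3) unique have "\<exists>!h. (g has_derivative h) (at x)"
    by (rule ex1I)
  moreover have "(THE h. (g has_derivative h) (at x)) = g'"
    using assms(3) unique by (rule the_equality)
  ultimately show ?thesis
    using \<open>x \<in> D\<close> by (simp add: rel_deriv_def within)
qed

text \<open>Restricting the function to the segment from \<open>x\<close> to \<open>y \<in> C\<close> shows that the derivative in direction
  \<open>y - x\<close> is a one-sided derivative of a function of one variable, hence unique. The differences
  \<open>y - x\<close> cover a translated ball, so by linearity they determine the derivative. Unlike the
  coordinate criterion of \<open>frechet_derivative_unique_within\<close>, this covers corners so sharp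
  that a coordinate line through \<open>x\<close> meets \<open>C\<close> only in \<open>x\<close>.\<close>

lemma convex_body_derivative_unique:
  fixes g :: "'a::real_normed_vector \<Rightarrow> 'b::real_normed_vector"
  assumes "convex C" "interior C \<noteq> {}" "x \<in> C"
    and A: "(g has_derivative A) (at x within C)"
    and B: "(g has_derivative B) (at x within C)"
  shows "A = B"
proof -
  have agree: "A (y - x) = B (y - x)" if "y \<in> C" for y
  proof -
    define p where "p = (\<lambda>s::real. x + s *\<^sub>R (y - x))"
    have p_in: "p ` {0..1} \<subseteq> C"
    proof
      fix z assume "z \<in> p ` {0..1}"
      then obtain s where s: "0 \<le> s" "s \<le> 1" "z = (1 - s) *\<^sub>R x + s *\<^sub>R y"
        by (auto simp: p_def algebra_simps)
      with \<open>convex C\<close> \<open>x \<in> C\<close> \<open>y \<in> C\<close> show "z \<in> C"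
        by (auto intro: convexD)
    qed
    have p': "(p has_derivative (\<lambda>s. s *\<^sub>R (y - x))) (at 0 within {0..1})"
      unfolding p_def by (auto intro!: derivative_eq_intros)
    have chain: "((g \<circ> p) has_vector_derivative D (y - x)) (at 0 within {0..1})"
      if D: "(g has_derivative D) (at x within C)" for D
    proof -
      have "(g has_derivative D) (at (p 0) within p ` {0..1})"
        using has_derivative_subset[OF D p_in] by (simp add: p_def)
      from diff_chain_within[OF p' this]
      show ?thesis
        using linear_scale[OF has_derivative_linear[OF D]]
        by (simp add: has_vector_derivative_def o_def)
    qed
    show ?thesis
      using vector_derivative_unique_within_closed_interval[of 0 1 "0::real" "g \<circ> p"]
        chain[OF A] chain[OF B] by simp
  qed
  have linA: "linear A" and linB: "linear B"
    using A B by (auto dest: has_derivative_linear)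
  obtain c r where "r > 0" and ball: "ball c r \<subseteq> C"
    using \<open>interior C \<noteq> {}\<close> by (auto simp: mem_interior)
  have small: "A h = B h" if "norm h < r" for h
  proof -
    have "c \<in> C" "c + h \<in> C"
      using ball that \<open>r > 0\<close> by (auto simp: dist_norm subset_iff)
    then have "A ((c + h - x) - (c - x)) = B ((c + h - x) - (c - x))"
      using agree by (simp only: linear_diff[OF linA] linear_diff[OF linB])
    then show ?thesis by simp
  qed
  show "A = B"
  proof
    fix h :: 'a
    \<comment> \<open>shrinks \<open>h\<close> below the radius \<open>r\<close>, also if \<open>h = 0\<close>\<close>
    define k where "k = r / (2 * (norm h + 1))"
    have "k > 0" using \<open>r > 0\<close> by (simp add: k_def add_nonneg_pos)
    have "norm (k *\<^sub>R h) = r * (norm h / (2 * (norm h + 1)))"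
      using \<open>k > 0\<close> by (simp add: k_def) (simp add: \<open>r > 0\<close> less_imp_le abs_of_nonneg)
    also have "\<dots> < r"
      using \<open>r > 0\<close> by (simp add: divide_less_eq add_nonneg_pos)
    finally have "A (k *\<^sub>R h) = B (k *\<^sub>R h)"
      by (rule small)
    then show "A h = B h"
      using \<open>k > 0\<close> by (simp add: linear_scale[OF linA] linear_scale[OF linB])
  qed
qed

lemma rel_deriv_convex_body:
  assumes "convex C" "interior C \<noteq> {}" "x \<in> C" "g differentiable_on C"
  shows "rel_deriv C g x \<noteq> None"
proof -
  obtain g' where "(g has_derivative g') (at x within C)"
    using assms by (auto simp: differentiable_on_def differentiable_def)
  then have "\<exists>!g'. (g has_derivative g') (at x within C)"
    using convex_body_derivative_unique[OF assms(1-3)] by blast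
  with \<open>x \<in> C\<close> show ?thesis by (simp add: rel_deriv_def)
qed

section \<open>Edges of a convex polygon\<close>

lemma inner_right_normal: "right_normal t \<bullet> d = t $ 2 * d $ 1 - t $ 1 * d $ 2"
  by (simp add: right_normal_def inner_vec_def sum_2 algebra_simps)

lemma norm_eq_1_real2: "norm (t::real^2) = 1 \<longleftrightarrow> t $ 1 * t $ 1 + t $ 2 * t $ 2 = 1"
  by (simp add: norm_eq_1 inner_vec_def sum_2)

lemma orthogonal_right_normal_imp_parallel:
  assumes "norm t = 1" "right_normal t \<bullet> d = 0"
  shows "d = (t \<bullet> d) *\<^sub>R t"
proof -
  have t: "t $ 1 * t $ 1 + t $ 2 * t $ 2 = 1" and d: "t $ 2 * d $ 1 = t $ 1 * d $ 2"
    using assms by (auto simp: norm_eq_1_real2 inner_right_normal)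
  have "d $ 1 = (t $ 1 * d $ 1 + t $ 2 * d $ 2) * t $ 1"
    using t d by algebra
  moreover have "d $ 2 = (t $ 1 * d $ 1 + t $ 2 * d $ 2) * t $ 2"
    using t d by algebra
  ultimately show ?thesis
    by (simp add: vec_eq_iff forall_2 inner_vec_def sum_2)
qed

lemma right_normal_nonzero:
  assumes "norm t = 1"
  shows "right_normal t \<noteq> 0"
proof
  assume "right_normal t = 0"
  then have "t $ 1 = 0 \<and> t $ 2 = 0"
    by (simp add: right_normal_def vec_eq_iff forall_2)
  with assms show False by (simp add: norm_eq_1_real2)
qed

lemma tangent_points:
  assumes "unit_tangent_from x e t"
  obtains \<epsilon> where "\<epsilon> > 0" "x + \<epsilon> *\<^sub>R t \<in> e"
proof -
  have "\<forall>\<^sub>F \<epsilon> in at_right (0::real). 0 < \<epsilon> \<and> x + \<epsilon> *\<^sub>R t \<in> e"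
    using assms by (auto simp: unit_tangent_from_def eventually_conj_iff eventually_at_right_less)
  then show ?thesis
    using that eventually_happens[of _ "at_right (0::real)"] by (auto simp: trivial_limit_at_right_real)
qed

text \<open>The line through \<open>x\<close> in the tangent direction and the line spanned by the edge share two points,
  since a small step along the tangent stays in the edge.\<close>

lemma affine_hull_edge:
  assumes "aff_dim e = 1" "x \<in> e" "unit_tangent_from x e t"
  shows "affine hull e = {y. right_normal t \<bullet> (y - x) = 0}" (is "_ = ?L")
proof -
  have t: "norm t = 1" using assms(3) by (simp add: unit_tangent_from_def)
  obtain \<epsilon> where \<epsilon>: "\<epsilon> > 0" "x + \<epsilon> *\<^sub>R t \<in> e"
    using tangent_points[OF assms(3)] .
  have L: "?L = {y. right_normal t \<bullet> y = right_normal t \<bullet> x}"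
    by (simp add: inner_diff_right)
  have dim: "aff_dim ?L = 1"
    using right_normal_nonzero[OF t] by (simp add: L aff_dim_hyperplane)
  have "?L \<subseteq> affine hull e"
  proof
    fix y assume "y \<in> ?L"
    then have y: "y - x = (t \<bullet> (y - x)) *\<^sub>R t"
      using orthogonal_right_normal_imp_parallel[OF t] by simp
    define c where "c = (t \<bullet> (y - x)) / \<epsilon>"
    have "y = x + (c * \<epsilon>) *\<^sub>R t"
      using \<open>\<epsilon> > 0\<close> y by (simp add: c_def eq_diff_eq[symmetric] add.commute flip: diff_eq_eq)
    then have "y = (1 - c) *\<^sub>R x + c *\<^sub>R (x + \<epsilon> *\<^sub>R t)"
      by (simp add: algebra_simps)
    moreover have "x \<in> affine hull e" "x + \<epsilon> *\<^sub>R t \<in> affine hull e"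
      using \<epsilon> \<open>x \<in> e\<close> by (auto simp: hull_inc)
    ultimately show "y \<in> affine hull e"
      using affine_affine_hull[of e] by (simp add: affine_def)
  qed
  moreover have "affine ?L" by (simp add: L affine_hyperplane)
  moreover have "x \<in> ?L" by simp
  then have "?L \<noteq> {}" by blast
  ultimately show ?thesis
    using affine_dim_equal[of ?L "affine hull e"] dim assms(1) by simp
qed

lemma open_convex_polygonD:
  assumes "open_convex_polygon K"
  shows "open K" "convex K" "K \<noteq> {}" "polytope (closure K)" "convex (closure K)"
    "interior (closure K) = K" "aff_dim (closure K) = 2"
proof -
  show *: "open K" "convex K" "K \<noteq> {}" "polytope (closure K)"
    using assms by (auto simp: open_convex_polygon_def)
  then show "convex (closure K)" by simp
  show "interior (closure K) = K"
    using * by (simp add: convex_interior_closure interior_open)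
  show "aff_dim (closure K) = 2"
    using * by (simp add: aff_dim_open)
qed

lemma edge_disjoint_polygon:
  assumes "open_convex_polygon K" "e edge_of closure K"
  shows "e \<inter> K = {}"
proof -
  have "e \<noteq> closure K"
    using assms(2) open_convex_polygonD(7)[OF assms(1)] by (metis edge_of_def one_eq_numeral_iff semiring_norm(83))
  then show ?thesis
    using face_of_disjoint_interior[of e "closure K"] assms(2) open_convex_polygonD(6)[OF assms(1)]
    by (simp add: edge_of_def)
qed

text \<open>A face is cut out of a convex set by its own affine hull, which for an edge is a line.\<close>

lemma polygon_Int_edge_line:
  assumes K: "open_convex_polygon K" and e: "e edge_of closure K" "x \<in> e" "unit_tangent_from x e t"
    and y: "y \<in> closure K" "right_normal t \<bullet> (y - x) = 0"
  shows "y \<in> e"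
proof -
  have "y \<in> affine hull e"
    using affine_hull_edge[of e x t] e y by (simp add: edge_of_def)
  then show ?thesis
    using face_of_imp_eq_affine_Int[of "closure K" e] e(1) y(1) open_convex_polygonD[OF K]
    by (auto simp: edge_of_def)
qed

text \<open>A point of the open polygon on the line through the edge would belong to the edge, which consists of
  boundary points. So the signed distance to the line has no zero on the connected set \<open>K\<close>.\<close>

lemma polygon_one_side_of_edge:
  assumes K: "open_convex_polygon K" and e: "e edge_of closure K" "x \<in> e" "unit_tangent_from x e t"
  shows "(\<forall>y\<in>K. right_normal t \<bullet> (y - x) < 0) \<or> (\<forall>y\<in>K. right_normal t \<bullet> (y - x) > 0)"
proof -
  let ?h = "\<lambda>y. right_normal t \<bullet> (y - x)"
  have "connected (?h ` K)"
    using open_convex_polygonD(2)[OF K]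
    by (intro connected_continuous_image convex_connected continuous_intros)
  moreover have "0 \<notin> ?h ` K"
    using polygon_Int_edge_line[OF K e] edge_disjoint_polygon[OF K e(1)] closure_subset
    by fastforce
  ultimately have "\<not> (a < 0 \<and> 0 < b)" if "a \<in> ?h ` K" "b \<in> ?h ` K" for a b
    using that connectedD_interval[of "?h ` K" a b 0] by auto
  with \<open>0 \<notin> ?h ` K\<close> show ?thesis
    by (metis (no_types, lifting) imageI linorder_neqE_linordered_idom)
qed

lemma closure_one_side_of_edge:
  assumes K: "open_convex_polygon K" and e: "e edge_of closure K" "x \<in> e" "unit_tangent_from x e t"
  shows "(\<forall>y\<in>closure K. right_normal t \<bullet> (y - x) \<le> 0) \<or>
         (\<forall>y\<in>closure K. right_normal t \<bullet> (y - x) \<ge> 0)"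
proof -
  have closed: "closed {y. right_normal t \<bullet> (y - x) \<le> 0}" "closed {y. right_normal t \<bullet> (y - x) \<ge> 0}"
    by (auto intro!: closed_Collect_le continuous_intros)
  from polygon_one_side_of_edge[OF K e] show ?thesis
  proof
    assume "\<forall>y\<in>K. right_normal t \<bullet> (y - x) < 0"
    then have "closure K \<subseteq> {y. right_normal t \<bullet> (y - x) \<le> 0}"
      using closed by (intro closure_minimal) (auto intro: less_imp_le)
    then show ?thesis by auto
  next
    assume "\<forall>y\<in>K. right_normal t \<bullet> (y - x) > 0"
    then have "closure K \<subseteq> {y. right_normal t \<bullet> (y - x) \<ge> 0}"
      using closed by (intro closure_minimal) (auto intro: less_imp_le)
    then show ?thesis by auto
  qed
qed

text \<open>Take \<open>p\<close> in the relative interior of the common edge and move from \<open>p\<close> a little towards \<open>y \<in> K\<close>; this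
  stays in \<open>K\<close>. The step towards \<open>z\<close> that reaches the same height over the edge leads to a point that
  differs from this one by a small vector parallel to the edge. Shifting both \<open>p\<close> and \<open>z\<close> by that
  vector keeps \<open>p\<close> in the edge and \<open>z\<close> in the open set \<open>L\<close>, so the point reached in \<open>K\<close> also lies
  in \<open>L\<close>.\<close>

lemma same_side_cells_meet:
  assumes K: "open_convex_polygon K" "e edge_of closure K"
    and L: "open_convex_polygon L" "e edge_of closure L"
    and e: "x \<in> e" "unit_tangent_from x e t"
    and y: "y \<in> K" and z: "z \<in> L"
    and side: "(right_normal t \<bullet> (y - x)) * (right_normal t \<bullet> (z - x)) > 0"
  shows "K \<inter> L \<noteq> {}"
proof -
  let ?n = "right_normal t"
  note KD = open_convex_polygonD[OF K(1)] and LD = open_convex_polygonD[OF L(1)]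
  have eK: "e \<subseteq> closure K" and eL: "e \<subseteq> closure L" and dim: "aff_dim e = 1"
    using K L by (auto simp: edge_of_def dest: face_of_imp_subset)
  have "convex e" using K(2) by (auto simp: edge_of_def dest: face_of_imp_convex)
  then obtain p where p: "p \<in> rel_interior e"
    using rel_interior_eq_empty[of e] \<open>x \<in> e\<close> by auto
  obtain \<rho> where "\<rho> > 0" and \<rho>: "ball p \<rho> \<inter> affine hull e \<subseteq> e" and "p \<in> e"
    using p by (auto simp: mem_rel_interior_ball)
  have line: "affine hull e = {q. ?n \<bullet> (q - x) = 0}"
    using affine_hull_edge[OF dim e] .
  have np: "?n \<bullet> p = ?n \<bullet> x"
    using hull_inc[OF \<open>p \<in> e\<close>, of affine] by (simp add: line inner_diff_right)
  \<comment> \<open>\<open>r\<close> equalises the heights of \<open>y\<close> and \<open>z\<close> over the edge, so that \<open>v\<close> is parallel to it\<close>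
  define r where "r = (?n \<bullet> (y - x)) / (?n \<bullet> (z - x))"
  have "r > 0" and r: "r * (?n \<bullet> (z - x)) = ?n \<bullet> (y - x)"
    using side by (auto simp: r_def zero_less_mult_iff zero_less_divide_iff)
  define v where "v = (y - p) - r *\<^sub>R (z - p)"
  have nv: "?n \<bullet> v = 0"
    using r np by (simp add: v_def inner_diff_right algebra_simps)
  have "((\<lambda>s::real. p + s *\<^sub>R v) \<longlongrightarrow> p + 0 *\<^sub>R v) (at_right 0)"
    by (intro tendsto_intros)
  then have ev1: "\<forall>\<^sub>F s in at_right 0. p + s *\<^sub>R v \<in> ball p \<rho>"
    using \<open>\<rho> > 0\<close> by (intro topological_tendstoD) auto
  have "((\<lambda>s::real. z + s *\<^sub>R v) \<longlongrightarrow> z + 0 *\<^sub>R v) (at_right 0)"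
    by (intro tendsto_intros)
  then have ev2: "\<forall>\<^sub>F s in at_right 0. z + s *\<^sub>R v \<in> L"
    using z LD(1) by (intro topological_tendstoD) auto
  have "((\<lambda>s::real. s * r) \<longlongrightarrow> 0 * r) (at_right 0)"
    by (intro tendsto_intros)
  then have ev3: "\<forall>\<^sub>F s in at_right 0. s * r < 1"
    by (intro order_tendstoD) auto
  have ev4: "\<forall>\<^sub>F s in at_right (0::real). 0 < s \<and> s < 1"
    by (auto simp: eventually_at_right[of 0 1] intro!: exI[of _ 1])
  obtain s where s: "p + s *\<^sub>R v \<in> ball p \<rho>" "z + s *\<^sub>R v \<in> L" "s * r < 1" "0 < s" "s < 1"
    using eventually_happens[OF eventually_conj[OF ev1 eventually_conj[OF ev2 eventually_conj[OF ev3 ev4]]]]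
    by (auto simp: trivial_limit_at_right_real)
  have "?n \<bullet> (p + s *\<^sub>R v - x) = 0"
    using nv np by (simp add: inner_diff_right inner_add_right)
  then have "p + s *\<^sub>R v \<in> e"
    using s(1) \<rho> line by auto
  then have "p + s *\<^sub>R v - (s * r) *\<^sub>R (p + s *\<^sub>R v - (z + s *\<^sub>R v)) \<in> interior L"
    using LD eL s \<open>r > 0\<close> by (intro mem_interior_closure_convex_shrink) (auto simp: interior_open)
  moreover have "p - s *\<^sub>R (p - y) \<in> interior K"
    using KD eK \<open>p \<in> e\<close> y s by (intro mem_interior_closure_convex_shrink) (auto simp: interior_open)
  moreover have "p + s *\<^sub>R v - (s * r) *\<^sub>R (p + s *\<^sub>R v - (z + s *\<^sub>R v)) = p - s *\<^sub>R (p - y)"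
    by (simp add: v_def algebra_simps)
  ultimately show ?thesis
    using interior_subset by (metis disjoint_iff in_mono)
qed

section \<open>The angle of a polygon at a vertex\<close>

lemma right_normal_antisym: "right_normal t \<bullet> s = - (right_normal s \<bullet> t)"
  by (simp add: inner_right_normal)

text \<open>If the tangents were parallel, both edges would lie on one line, and each would be the whole
  intersection of that line with the polygon.\<close>

lemma distinct_edges_transversal:
  assumes K: "open_convex_polygon K"
    and e: "e edge_of closure K" "v \<in> e" "unit_tangent_from v e t"
    and f: "f edge_of closure K" "v \<in> f" "unit_tangent_from v f s"
    and "e \<noteq> f"
  shows "right_normal t \<bullet> s \<noteq> 0"
proof
  assume "right_normal t \<bullet> s = 0"
  have sub: "f' \<subseteq> e'"
    if e': "e' edge_of closure K" "v \<in> e'" "unit_tangent_from v e' t'"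
      and f': "f' edge_of closure K" "v \<in> f'" "unit_tangent_from v f' s'"
      and 0: "right_normal t' \<bullet> s' = 0" for e' f' t' s'
  proof
    fix y assume "y \<in> f'"
    then have "right_normal s' \<bullet> (y - v) = 0"
      using hull_inc[of y f' affine] affine_hull_edge[OF _ f'(2,3)] f'(1) by (simp add: edge_of_def)
    then have "y - v = (s' \<bullet> (y - v)) *\<^sub>R s'"
      using f'(3) by (intro orthogonal_right_normal_imp_parallel) (auto simp: unit_tangent_from_def)
    then have "right_normal t' \<bullet> (y - v) = 0"
      using 0 by (metis inner_scaleR_right mult_zero_right)
    moreover have "y \<in> closure K"
      using \<open>y \<in> f'\<close> edge_of_imp_subset[OF f'(1)] by auto
    ultimately show "y \<in> e'"
      using polygon_Int_edge_line[OF K e'] by auto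
  qed
  have "right_normal s \<bullet> t = 0"
    using \<open>right_normal t \<bullet> s = 0\<close> right_normal_antisym[of t s] by simp
  with sub[OF e f] sub[OF f e] \<open>right_normal t \<bullet> s = 0\<close> \<open>e \<noteq> f\<close> show False
    by auto
qed

lemma other_edges_same_side:
  assumes K: "open_convex_polygon K"
    and e: "e edge_of closure K" "v \<in> e" "unit_tangent_from v e t"
    and f: "f edge_of closure K" "v \<in> f" "unit_tangent_from v f s" "e \<noteq> f"
    and g: "g edge_of closure K" "v \<in> g" "unit_tangent_from v g r" "e \<noteq> g"
  shows "right_normal t \<bullet> s > 0 \<longleftrightarrow> right_normal t \<bullet> r > 0"
proof -
  obtain \<epsilon> \<delta> where \<epsilon>: "\<epsilon> > 0" "v + \<epsilon> *\<^sub>R s \<in> f" and \<delta>: "\<delta> > 0" "v + \<delta> *\<^sub>R r \<in> g"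
    using tangent_points[OF f(3)] tangent_points[OF g(3)] by metis
  have "v + \<epsilon> *\<^sub>R s \<in> closure K" "v + \<delta> *\<^sub>R r \<in> closure K"
    using edge_of_imp_subset[OF f(1)] edge_of_imp_subset[OF g(1)] \<epsilon> \<delta> by auto
  with closure_one_side_of_edge[OF K e] \<epsilon>(1) \<delta>(1)
  have "right_normal t \<bullet> s \<le> 0 \<and> right_normal t \<bullet> r \<le> 0 \<or>
        right_normal t \<bullet> s \<ge> 0 \<and> right_normal t \<bullet> r \<ge> 0"
    by (fastforce simp: mult_le_0_iff zero_le_mult_iff)
  with distinct_edges_transversal[OF K e f] distinct_edges_transversal[OF K e g]
  show ?thesis by auto
qed

text \<open>With \<open>c t s = right_normal t \<bullet> s\<close>, the polygon lying on one side of each of three edges would make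
  \<open>c t s\<close> and \<open>c t r\<close>, \<open>c s t\<close> and \<open>c s r\<close>, and \<open>c r t\<close> and \<open>c r s\<close> agree in sign. But \<open>c\<close> is
  antisymmetric and has no zero on these pairs, so if \<open>c t s\<close> is positive, then \<open>c t r\<close> is positive,
  \<open>c s t\<close> and \<open>c s r\<close> are negative, \<open>c r s\<close> and \<open>c r t\<close> are positive, and \<open>c t r\<close> is negative; the
  other case is symmetric.\<close>

lemma at_most_two_edges:
  assumes K: "open_convex_polygon K"
    and e: "e edge_of closure K" "v \<in> e" "unit_tangent_from v e t"
    and f: "f edge_of closure K" "v \<in> f" "unit_tangent_from v f s"
    and g: "g edge_of closure K" "v \<in> g" "unit_tangent_from v g r"
    and "e \<noteq> f"
  shows "g = e \<or> g = f"
proof (rule ccontr)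
  assume "\<not> (g = e \<or> g = f)"
  then have ne: "e \<noteq> g" "f \<noteq> g" "g \<noteq> e" "g \<noteq> f" "f \<noteq> e"
    using \<open>e \<noteq> f\<close> by auto
  show False
    using other_edges_same_side[OF K e f \<open>e \<noteq> f\<close> g ne(1)]
      other_edges_same_side[OF K f e ne(5) g ne(2)]
      other_edges_same_side[OF K g e ne(3) f ne(4)]
      distinct_edges_transversal[OF K e f \<open>e \<noteq> f\<close>]
      distinct_edges_transversal[OF K e g ne(1)]
      distinct_edges_transversal[OF K f g ne(2)]
      right_normal_antisym[of t s] right_normal_antisym[of t r] right_normal_antisym[of s r]
    by linarith
qed

text \<open>A proper nonempty face of a polyhedron is the intersection of the facets containing it. The facets
  of a polygon are its edges, and a single edge is more than a point.\<close>

lemma at_least_two_edges: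
  assumes K: "open_convex_polygon K" and v: "v extreme_point_of closure K"
  obtains e f where "e edge_of closure K" "v \<in> e" "f edge_of closure K" "v \<in> f" "e \<noteq> f"
proof -
  note KD = open_convex_polygonD[OF K]
  let ?F = "{F. F facet_of closure K \<and> {v} \<subseteq> F}"
  have face: "{v} face_of closure K" using v by (simp add: face_of_singleton)
  have poly: "polyhedron (closure K)" using KD by (simp add: polytope_imp_polyhedron)
  have ne: "{v} \<noteq> closure K" using KD(7) by (metis aff_dim_sing zero_neq_numeral)
  have Int: "{v} = \<Inter>?F"
    by (rule face_of_polyhedron[OF poly face _ ne]) simp
  obtain F where F: "F facet_of closure K" "v \<in> F"
    using face_of_polyhedron_subset_facet[OF poly face _ ne] by auto
  have "\<exists>H\<in>?F. H \<noteq> F"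
  proof (rule ccontr)
    assume "\<not> (\<exists>H\<in>?F. H \<noteq> F)"
    with F have "?F = {F}" by blast
    with Int have "{v} = \<Inter>{F}" by metis
    then have "F = {v}" by simp
    with F KD(7) show False by (simp add: facet_of_def)
  qed
  then obtain H where "H facet_of closure K" "v \<in> H" "H \<noteq> F" by auto
  with F KD(7) that[of F H] show ?thesis
    by (auto simp: facet_of_def edge_of_def)
qed

text \<open>Two tangents of a segment are equal or opposite, and an end point of the segment excludes opposite
  ones.\<close>

lemma unit_tangent_from_extreme_point_unique:
  assumes dim: "aff_dim e = 1" and v: "v extreme_point_of e"
    and t: "unit_tangent_from v e t" and s: "unit_tangent_from v e s"
  shows "s = t"
proof -
  have "v \<in> e" using v by (simp add: extreme_point_of_def)
  have norms: "norm t = 1" "norm s = 1" using t s by (auto simp: unit_tangent_from_def)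
  have "\<forall>\<^sub>F \<epsilon> in at_right (0::real). 0 < \<epsilon> \<and> v + \<epsilon> *\<^sub>R t \<in> e \<and> v + \<epsilon> *\<^sub>R s \<in> e"
    using t s by (auto simp: unit_tangent_from_def eventually_conj_iff eventually_at_right_less)
  then obtain \<epsilon> :: real where \<epsilon>: "\<epsilon> > 0" "v + \<epsilon> *\<^sub>R t \<in> e" "v + \<epsilon> *\<^sub>R s \<in> e"
    using eventually_happens[of _ "at_right (0::real)"] by (auto simp: trivial_limit_at_right_real)
  have "right_normal t \<bullet> (\<epsilon> *\<^sub>R s) = 0"
    using hull_inc[OF \<epsilon>(3), of affine] affine_hull_edge[OF dim \<open>v \<in> e\<close> t] by simp
  then have st: "s = (t \<bullet> s) *\<^sub>R t"
    using \<epsilon>(1) by (intro orthogonal_right_normal_imp_parallel norms) simp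
  then have "\<bar>t \<bullet> s\<bar> = 1"
    using norms by (metis mult.right_neutral norm_scaleR)
  then consider "t \<bullet> s = 1" | "t \<bullet> s = -1" by linarith
  then show ?thesis
  proof cases
    case 1 with st show ?thesis by simp
  next
    case 2
    have "t \<noteq> 0" using norms by auto
    have "v = midpoint (v + \<epsilon> *\<^sub>R t) (v + \<epsilon> *\<^sub>R s)"
      using st 2 by (simp add: midpoint_def algebra_simps flip: scaleR_2)
    moreover have "v + \<epsilon> *\<^sub>R t \<noteq> v + \<epsilon> *\<^sub>R s"
    proof
      assume "v + \<epsilon> *\<^sub>R t = v + \<epsilon> *\<^sub>R s"
      then have "s = t" using \<epsilon>(1) by simp
      with 2 norms show False by (simp add: norm_eq_1)
    qed
    ultimately have "v \<in> open_segment (v + \<epsilon> *\<^sub>R t) (v + \<epsilon> *\<^sub>R s)"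
      by (metis midpoint_in_open_segment)
    with v \<epsilon> show ?thesis by (auto simp: extreme_point_of_def)
  qed
qed

text \<open>With exactly two edges at \<open>v\<close>, each with one tangent, the only freedom in the definition of the
  angle is the order of the edges, and the inner product is symmetric. Transversality of the
  edges keeps the cosine below \<open>1\<close>.\<close>

lemma interior_angle_pos:
  assumes K: "open_convex_polygon K" and v: "v extreme_point_of closure K"
    and tan: "\<And>e. e edge_of closure K \<Longrightarrow> v \<in> e \<Longrightarrow> unit_tangent_from v e (\<tau> e)"
  shows "interior_angle K v > 0"
proof -
  obtain e f where e: "e edge_of closure K" "v \<in> e" and f: "f edge_of closure K" "v \<in> f"
    and "e \<noteq> f"
    using at_least_two_edges[OF K v] .
  have uniq: "t = \<tau> g" if "g edge_of closure K" "v \<in> g" "unit_tangent_from v g t" for g t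
    using that v tan[OF that(1,2)]
    by (intro unit_tangent_from_extreme_point_unique[of g v])
      (auto simp: edge_of_def extreme_point_of_face)
  have "interior_angle K v = arccos (\<tau> e \<bullet> \<tau> f)"
    unfolding interior_angle_def
  proof (rule the_equality)
    show "\<exists>e1 e2 t1 t2. e1 edge_of closure K \<and> e2 edge_of closure K \<and> e1 \<noteq> e2 \<and>
        unit_tangent_from v e1 t1 \<and> unit_tangent_from v e2 t2 \<and> v \<in> e1 \<and> v \<in> e2 \<and>
        arccos (\<tau> e \<bullet> \<tau> f) = arccos (t1 \<bullet> t2)"
      using e f tan[OF e] tan[OF f] \<open>e \<noteq> f\<close> by blast
  next
    fix \<theta>
    assume "\<exists>e1 e2 t1 t2. e1 edge_of closure K \<and> e2 edge_of closure K \<and> e1 \<noteq> e2 \<and>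
        unit_tangent_from v e1 t1 \<and> unit_tangent_from v e2 t2 \<and> v \<in> e1 \<and> v \<in> e2 \<and>
        \<theta> = arccos (t1 \<bullet> t2)"
    then obtain e1 e2 where e1: "e1 edge_of closure K" "v \<in> e1" and e2: "e2 edge_of closure K" "v \<in> e2"
      and "e1 \<noteq> e2" and \<theta>: "\<theta> = arccos (\<tau> e1 \<bullet> \<tau> e2)"
      using uniq by blast
    have "e1 = e \<or> e1 = f" "e2 = e \<or> e2 = f"
      using at_most_two_edges[OF K e tan[OF e] f tan[OF f] _ _ _ \<open>e \<noteq> f\<close>]
        e1 tan[OF e1] e2 tan[OF e2] by blast+
    with \<open>e1 \<noteq> e2\<close> \<theta> show "\<theta> = arccos (\<tau> e \<bullet> \<tau> f)"
      by (auto simp: inner_commute)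
  qed
  moreover have "arccos (\<tau> e \<bullet> \<tau> f) > 0"
  proof -
    have norms: "norm (\<tau> e) = 1" "norm (\<tau> f) = 1"
      using tan[OF e] tan[OF f] by (auto simp: unit_tangent_from_def)
    have bound: "\<bar>\<tau> e \<bullet> \<tau> f\<bar> \<le> 1"
      using Cauchy_Schwarz_ineq2[of "\<tau> e" "\<tau> f"] norms by simp
    have "\<tau> e \<bullet> \<tau> f \<noteq> 1"
    proof
      assume "\<tau> e \<bullet> \<tau> f = 1"
      then have "\<tau> e = \<tau> f"
        using norm_cauchy_schwarz_eq[of "\<tau> e" "\<tau> f"] norms by simp
      then have "right_normal (\<tau> e) \<bullet> \<tau> f = 0"
        by (simp add: inner_right_normal)
      with distinct_edges_transversal[OF K e tan[OF e] f tan[OF f] \<open>e \<noteq> f\<close>] show False by simp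
    qed
    with bound have "arccos 1 < arccos (\<tau> e \<bullet> \<tau> f)"
      by (intro arccos_less_arccos) auto
    then show ?thesis by simp
  qed
  ultimately show ?thesis by simp
qed

section \<open>Cells, edges and weights of the mesh\<close>

lemma conforming_meshD:
  assumes "conforming_mesh \<Omega> \<T>"
  shows "finite \<T>" "K \<in> \<T> \<Longrightarrow> open_convex_polygon K"
    "K \<in> \<T> \<Longrightarrow> L \<in> \<T> \<Longrightarrow> K \<inter> L \<noteq> {} \<Longrightarrow> K = L"
    "K \<in> \<T> \<Longrightarrow> L \<in> \<T> \<Longrightarrow> K \<noteq> L \<Longrightarrow> (closure K \<inter> closure L) face_of closure K"
    "K \<in> \<T> \<Longrightarrow> L \<in> \<T> \<Longrightarrow> K \<noteq> L \<Longrightarrow> (closure K \<inter> closure L) face_of closure L"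
proof -
  show "finite \<T>" "K \<in> \<T> \<Longrightarrow> open_convex_polygon K"
    using assms by (simp_all add: conforming_mesh_def)
  have "pairwise disjnt \<T>" using assms by (simp add: conforming_mesh_def)
  then show "K \<in> \<T> \<Longrightarrow> L \<in> \<T> \<Longrightarrow> K \<inter> L \<noteq> {} \<Longrightarrow> K = L"
    by (auto simp: pairwise_def disjnt_def)
  show "K \<in> \<T> \<Longrightarrow> L \<in> \<T> \<Longrightarrow> K \<noteq> L \<Longrightarrow> (closure K \<inter> closure L) face_of closure K"
    and "K \<in> \<T> \<Longrightarrow> L \<in> \<T> \<Longrightarrow> K \<noteq> L \<Longrightarrow> (closure K \<inter> closure L) face_of closure L"
    using assms by (simp_all add: conforming_mesh_def)
qed

lemma finite_mesh_edges:
  assumes "conforming_mesh \<Omega> \<T>"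
  shows "finite (mesh_edges \<T>)"
proof -
  have "mesh_edges \<T> \<subseteq> (\<Union>K\<in>\<T>. {F. F face_of closure K})"
    by (auto simp: mesh_edges_def edge_of_def)
  moreover have "finite (\<Union>K\<in>\<T>. {F. F face_of closure K})"
    using conforming_meshD(1,2)[OF assms]
    by (auto intro!: finite_polytope_faces dest: open_convex_polygonD(4))
  ultimately show ?thesis by (rule finite_subset)
qed

text \<open>A mesh vertex is an extreme point of some cell by definition. By conformity the intersection with any
  other cell is a face of both, which transports extremality from one cell to the other.\<close>

lemma mesh_vertex_extreme:
  assumes mesh: "conforming_mesh \<Omega> \<T>" and v: "v \<in> mesh_vertices \<T>"
    and K: "K \<in> \<T>" "v \<in> closure K"
  shows "v extreme_point_of closure K"
proof -
  obtain L where L: "L \<in> \<T>" "v extreme_point_of closure L"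
    using v by (auto simp: mesh_vertices_def)
  show ?thesis
  proof (cases "K = L")
    case False
    have "v \<in> closure L" using L(2) by (simp add: extreme_point_of_def)
    with L(2) K(2) conforming_meshD(5)[OF mesh K(1) L(1) False]
    have "v extreme_point_of (closure K \<inter> closure L)"
      by (simp add: extreme_point_of_face)
    then show ?thesis
      using extreme_point_of_face[OF conforming_meshD(4)[OF mesh K(1) L(1) False]] by simp
  qed (use L in simp)
qed

lemma the_cell_SomeD:
  assumes "the_cell X = Some K" and "\<And>A B. A \<in> X \<Longrightarrow> B \<in> X \<Longrightarrow> A = B"
  shows "K \<in> X"
proof -
  obtain A where "A \<in> X" "K = (THE K. K \<in> X)"
    using assms(1) by (auto simp: the_cell_def split: if_splits)
  moreover have "(THE K. K \<in> X) = A"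
    using \<open>A \<in> X\<close> assms(2) by (intro the_equality)
  ultimately show ?thesis by simp
qed

text \<open>The definite description that selects the cell denotes a member of the candidate set only if there is
  no second candidate; that is where the disjointness of the cells enters.\<close>

lemma cell_at_adjacent:
  assumes mesh: "conforming_mesh \<Omega> (cells S)"
    and e: "coord \<sigma> \<in> e" "unit_tangent_from (coord \<sigma>) e (tangent S \<sigma> e)"
    and s: "s = Minus \<or> s = Plus" "cell_at S \<sigma> e s = Some K"
  shows "K \<in> cells S \<and> e edge_of closure K"
proof -
  define h where "h = (\<lambda>y. normal S \<sigma> e \<bullet> (y - coord \<sigma>))"
  have one: "A = B"
    if A: "A \<in> cells S" "e edge_of closure A" and B: "B \<in> cells S" "e edge_of closure B"
      and "(\<forall>y\<in>A. h y < 0) \<and> (\<forall>y\<in>B. h y < 0) \<or> (\<forall>y\<in>A. h y > 0) \<and> (\<forall>y\<in>B. h y > 0)" for A B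
  proof -
    note AD = conforming_meshD(2)[OF mesh A(1)] and BD = conforming_meshD(2)[OF mesh B(1)]
    obtain y z where y: "y \<in> A" and z: "z \<in> B"
      using open_convex_polygonD(3)[OF AD] open_convex_polygonD(3)[OF BD] by auto
    then have "h y * h z > 0" using that(5) by (auto simp: zero_less_mult_iff)
    then have "A \<inter> B \<noteq> {}"
      using same_side_cells_meet[OF AD A(2) BD B(2) e y z] by (simp add: h_def normal_def)
    then show ?thesis using conforming_meshD(3)[OF mesh A(1) B(1)] by simp
  qed
  from s(1) show ?thesis
  proof
    assume "s = Minus"
    with s(2) have "the_cell {K \<in> cells S. e edge_of closure K \<and> (\<forall>y\<in>K. h y < 0)} = Some K"
      by (simp add: h_def)
    from the_cell_SomeD[OF this] one show ?thesis by blast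
  next
    assume "s = Plus"
    with s(2) have "the_cell {K \<in> cells S. e edge_of closure K \<and> (\<forall>y\<in>K. h y > 0)} = Some K"
      by (simp add: h_def)
    from the_cell_SomeD[OF this] one show ?thesis by blast
  qed
qed

lemma edge_has_adjacent_cell:
  assumes mesh: "conforming_mesh \<Omega> (cells S)" and "e \<in> mesh_edges (cells S)"
    and e: "coord \<sigma> \<in> e" "unit_tangent_from (coord \<sigma>) e (tangent S \<sigma> e)"
  shows "cell_at S \<sigma> e Minus \<noteq> None \<or> cell_at S \<sigma> e Plus \<noteq> None"
proof -
  obtain K where K: "K \<in> cells S" "e edge_of closure K"
    using assms(2) by (auto simp: mesh_edges_def)
  from polygon_one_side_of_edge[OF conforming_meshD(2)[OF mesh K(1)] K(2) e] K
  show ?thesis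
    by (auto simp: the_cell_def normal_def)
qed

lemma ext_candidates_closure:
  assumes "K \<in> ext_candidates S \<sigma> e"
  shows "coord \<sigma> \<in> closure K"
proof -
  have "((\<lambda>\<epsilon>::real. coord \<sigma> - \<epsilon> *\<^sub>R tangent S \<sigma> e) \<longlongrightarrow> coord \<sigma> - 0 *\<^sub>R tangent S \<sigma> e) (at_right 0)"
    by (intro tendsto_intros)
  moreover have "\<forall>\<^sub>F \<epsilon> in at_right 0. coord \<sigma> - \<epsilon> *\<^sub>R tangent S \<sigma> e \<in> closure K"
    using assms by (simp add: ext_candidates_def)
  ultimately have "coord \<sigma> - 0 *\<^sub>R tangent S \<sigma> e \<in> closure K"
    by (intro Lim_in_closed_set[of _ _ "at_right (0::real)"]) (auto simp: trivial_limit_at_right_real)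
  then show ?thesis by simp
qed

text \<open>Each edge at a vertex has at least one adjacent cell, whose angle contributes a positive amount to
  the total.\<close>

lemma edge_weight_defined:
  assumes mesh: "conforming_mesh \<Omega> (cells S)" and v: "v \<in> mesh_vertices (cells S)"
    and tan: "\<And>e. e \<in> edges_at S (Vertex v) \<Longrightarrow> unit_tangent_from v e (tangent S (Vertex v) e)"
  shows "edge_weight S (Vertex v) e \<noteq> None"
proof -
  let ?\<sigma> = "Vertex v"
  have angle: "interior_angle K v > 0" if "K \<in> cells S" "v \<in> closure K" for K
  proof (rule interior_angle_pos)
    show "open_convex_polygon K" using conforming_meshD(2)[OF mesh that(1)] .
    show "v extreme_point_of closure K" using mesh_vertex_extreme[OF mesh v that] .
    show "unit_tangent_from v f (tangent S ?\<sigma> f)" if "f edge_of closure K" "v \<in> f" for f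
      using that \<open>K \<in> cells S\<close> by (intro tan) (auto simp: edges_at_def mesh_edges_def)
  qed
  have pos: "edge_angle S ?\<sigma> f > 0" if f: "f \<in> edges_at S ?\<sigma>" for f
  proof -
    have f': "f \<in> mesh_edges (cells S)" "coord ?\<sigma> \<in> f" "unit_tangent_from (coord ?\<sigma>) f (tangent S ?\<sigma> f)"
      using f tan[OF f] by (auto simp: edges_at_def)
    have *: "interior_angle K v > 0" if "s = Minus \<or> s = Plus" "cell_at S ?\<sigma> f s = Some K" for s K
      using cell_at_adjacent[OF mesh f'(2,3) that] f'(2) edge_of_imp_subset[of f "closure K"]
      by (intro angle) auto
    show ?thesis
      using edge_has_adjacent_cell[OF mesh f'] *[of Minus] *[of Plus]
      by (auto simp: edge_angle_def simp del: cell_at.simps split: option.split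
          intro: add_pos_pos)
  qed
  obtain L where L: "L \<in> cells S" "v extreme_point_of closure L"
    using v by (auto simp: mesh_vertices_def)
  obtain f where "f edge_of closure L" "v \<in> f"
    using at_least_two_edges[OF conforming_meshD(2)[OF mesh L(1)] L(2)] .
  then have "edges_at S ?\<sigma> \<noteq> {}"
    using L(1) by (auto simp: edges_at_def mesh_edges_def)
  moreover have "finite (edges_at S ?\<sigma>)"
    using finite_mesh_edges[OF mesh] by (auto simp: edges_at_def)
  ultimately have "(\<Sum>f\<in>edges_at S ?\<sigma>. edge_angle S ?\<sigma> f) > 0"
    using pos by (intro sum_pos) auto
  then show ?thesis
    by (simp add: edge_weight_def Let_def)
qed

text \<open>An edge is compact, convex and one-dimensional, hence a segment, and a segment determines the
  unordered pair of its end points.\<close>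

lemma coord_Midpoint_in_edge:
  assumes mesh: "conforming_mesh \<Omega> \<T>" and e: "e \<in> mesh_edges \<T>"
  shows "coord (Midpoint e) \<in> e"
proof -
  obtain K where K: "K \<in> \<T>" "e edge_of closure K"
    using e by (auto simp: mesh_edges_def)
  note KD = open_convex_polygonD[OF conforming_meshD(2)[OF mesh K(1)]]
  have face: "e face_of closure K" and dim: "aff_dim e = 1" using K(2) by (auto simp: edge_of_def)
  have "compact e"
    using face_of_imp_compact[OF KD(5) polytope_imp_compact[OF KD(4)] face] .
  moreover have "convex e" using face_of_imp_convex[OF face] .
  moreover have "e \<noteq> {}" "collinear e" using dim by (auto simp: collinear_aff_dim)
  ultimately obtain a b where ab: "e = closed_segment a b"
    using compact_convex_collinear_segment[of e] by blast
  have "coord (Midpoint e) = midpoint a b"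
    unfolding coord.simps
  proof (rule the_equality)
    fix x assume "\<exists>c d. e = closed_segment c d \<and> x = midpoint c d"
    then obtain c d where "closed_segment a b = closed_segment c d" "x = midpoint c d"
      using ab by auto
    then show "x = midpoint a b"
      by (auto simp: doubleton_eq_iff midpoint_sym)
  qed (use ab in auto)
  then show ?thesis by (simp add: ab)
qed

section \<open>Well-definedness of the point operator\<close>

lemma J_dir_defined:
  assumes "open G" "hyperbolic_on G (flux S)" "fwd_dom S = G"
    and "admissibility_transform G (flux S) (fwd S)" "pt_state S \<sigma> \<in> G"
  shows "J_dir S \<sigma> q \<noteq> None"
proof -
  let ?u = "pt_state S \<sigma>"
  obtain P where P: "rel_deriv G (fwd S) ?u = Some ((*v) P)" "invertible P"
    using assms rel_deriv_open[OF \<open>open G\<close>] unfolding admissibility_transform_def by blast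
  have "\<exists>A. rel_deriv UNIV (flux S i) ?u = Some A" for i
    using assms(2,5) rel_deriv_open[OF open_UNIV UNIV_I] unfolding hyperbolic_on_def by blast
  then obtain A where "\<And>i. rel_deriv UNIV (flux S i) ?u = Some (A i)"
    by metis
  then have "transformed_jacobian G (fwd S) (flux S) i ?u \<noteq> None" for i
    using P by (simp add: transformed_jacobian_def)
  then obtain J1 J2 where "transformed_jacobian G (fwd S) (flux S) 1 ?u = Some J1"
    "transformed_jacobian G (fwd S) (flux S) 2 ?u = Some J2"
    by blast
  then show ?thesis
    using assms(3) by (simp add: J_dir_def)
qed

lemma opt_mult_defined: "M \<noteq> None \<Longrightarrow> x \<noteq> None \<Longrightarrow> opt_mult M x \<noteq> None"
  by (auto simp: opt_mult_def)

lemma opt_add_defined: "x \<noteq> None \<Longrightarrow> y \<noteq> None \<Longrightarrow> opt_add x y \<noteq> None"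
  by (auto simp: opt_add_def)

lemma point_op_defined:
  assumes J: "\<And>q. J_dir S \<sigma> q \<noteq> None"
    and D: "\<And>e s q. (e, s, q) \<in> stencil S \<sigma> \<Longrightarrow> dir_deriv S \<sigma> e s q \<noteq> None"
    and W: "\<And>v e. \<sigma> = Vertex v \<Longrightarrow> edge_weight S \<sigma> e \<noteq> None"
    and fin: "finite (edges_at S \<sigma>)"
  shows "point_op S \<sigma> \<noteq> None"
proof -
  have J': "J_plus S \<sigma> q \<noteq> None" "J_minus S \<sigma> q \<noteq> None" for q
    using J[of q] by (auto simp: J_plus_def J_minus_def)
  show ?thesis
  proof (cases \<sigma>)
    case (Vertex v)
    have terms: "opt_add (normal_part S \<sigma> e) (vertex_tangential_part S \<sigma> e) \<noteq> None"
      if "e \<in> edges_at S \<sigma>" for e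
    proof -
      have "(e, Minus, normal S \<sigma> e) \<in> stencil S \<sigma>" "(e, Plus, normal S \<sigma> e) \<in> stencil S \<sigma>"
        "(e, Minus, tangent S \<sigma> e) \<in> stencil S \<sigma>" "(e, Ext, tangent S \<sigma> e) \<in> stencil S \<sigma>"
        using that by (auto simp: Vertex Let_def)
      from this[THEN D] J' show ?thesis
        unfolding normal_part_def vertex_tangential_part_def Let_def
        by (intro opt_add_defined opt_mult_defined)
    qed
    have "edge_weight S \<sigma> e \<bind> (\<lambda>\<omega>. opt_add (normal_part S \<sigma> e) (vertex_tangential_part S \<sigma> e)
        \<bind> (\<lambda>r. Some (\<omega> *\<^sub>R r))) \<noteq> None" if "e \<in> edges_at S \<sigma>" for e
    proof -
      obtain r \<omega> where "opt_add (normal_part S \<sigma> e) (vertex_tangential_part S \<sigma> e) = Some r"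
        and "edge_weight S \<sigma> e = Some \<omega>"
        using terms[OF \<open>e \<in> edges_at S \<sigma>\<close>] W[OF Vertex, of e] by blast
      then show ?thesis by simp
    qed
    with fin show ?thesis
      unfolding Vertex by (simp add: Let_def opt_sum_def)
  next
    case (Midpoint e)
    have "(e, Minus, normal S \<sigma> e) \<in> stencil S \<sigma>" "(e, Plus, normal S \<sigma> e) \<in> stencil S \<sigma>"
      "(e, Minus, tangent S \<sigma> e) \<in> stencil S \<sigma>"
      by (auto simp: Midpoint Let_def)
    from this[THEN D] J J' have
      "opt_add (normal_part S \<sigma> e) (midpoint_tangential_part S \<sigma> e) \<noteq> None"
      unfolding normal_part_def midpoint_tangential_part_def Let_def
      by (intro opt_add_defined opt_mult_defined)
    then show ?thesis by (simp add: Midpoint Let_def)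
  qed
qed

lemma stencil_edge:
  assumes mesh: "conforming_mesh \<Omega> (cells S)" and nodes: "valid_nodes S" "\<sigma> \<in> nodes S"
    and st: "(e, s, q) \<in> stencil S \<sigma>"
  shows "e \<in> edges_at S \<sigma>" "s = Ext \<Longrightarrow> \<exists>v. \<sigma> = Vertex v"
proof -
  show "e \<in> edges_at S \<sigma>"
  proof (cases \<sigma>)
    case (Midpoint f)
    with nodes have "f \<in> mesh_edges (cells S)"
      unfolding valid_nodes_def by blast
    with coord_Midpoint_in_edge[OF mesh this] st Midpoint show ?thesis
      by (auto simp: edges_at_def Let_def)
  qed (use st in \<open>auto simp: Let_def\<close>)
  show "\<exists>v. \<sigma> = Vertex v" if "s = Ext"
    using st that by (cases \<sigma>) (auto simp: Let_def)
qed

text \<open>The interface between mesh and differentiation: every cell whose trace is used has the node in its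
  closure, so that the derivative of the reconstruction relative to that closure can be taken.\<close>

lemma stencil_cell:
  assumes mesh: "conforming_mesh \<Omega> (cells S)" and nodes: "valid_nodes S" "\<sigma> \<in> nodes S"
    and orient: "valid_orientation S"
    and st: "(e, s, q) \<in> stencil S \<sigma>" and K: "cell_at S \<sigma> e s = Some K"
  shows "K \<in> cells S \<and> coord \<sigma> \<in> closure K"
proof -
  have e: "e \<in> edges_at S \<sigma>" and ext: "s = Ext \<Longrightarrow> \<exists>v. \<sigma> = Vertex v"
    using stencil_edge[OF mesh nodes st] by auto
  show ?thesis
  proof (cases "s = Ext")
    case True
    then obtain v where "\<sigma> = Vertex v" using ext by auto
    with True K e nodes orient have "K \<in> ext_candidates S \<sigma> e"
      by (fastforce simp: valid_orientation_def)
    then show ?thesis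
      using ext_candidates_closure[of K S \<sigma> e] by (auto simp: ext_candidates_def)
  next
    case False
    then have "s = Minus \<or> s = Plus" by (cases s) auto
    moreover have "coord \<sigma> \<in> e" "unit_tangent_from (coord \<sigma>) e (tangent S \<sigma> e)"
      using e orient nodes by (auto simp: edges_at_def valid_orientation_def)
    ultimately have "K \<in> cells S \<and> e edge_of closure K"
      using cell_at_adjacent[OF mesh] K by blast
    then show ?thesis
      using \<open>coord \<sigma> \<in> e\<close> edge_of_imp_subset by blast
  qed
qed

lemma exact_point_op_defined:
  assumes "open G" "hyperbolic_on G (flux S)" and mesh: "conforming_mesh \<Omega> (cells S)"
    and nodes: "valid_nodes S" "\<sigma> \<in> nodes S" and rec: "valid_reconstruction S"
    and orient: "valid_orientation S" and exact: "exact_setting S G \<B> Gpt w"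
  shows "point_op S \<sigma> \<noteq> None"
proof (rule point_op_defined)
  have dom: "fwd_dom S = G" and adm: "admissibility_transform G (flux S) (fwd S)"
    and bd: "boundary_data_supplied S" and state: "pt_state S \<sigma> \<in> G"
    using exact nodes by (auto simp: exact_setting_def)
  show "J_dir S \<sigma> q \<noteq> None" for q
    using J_dir_defined[OF assms(1,2) dom adm state] .
  show "dir_deriv S \<sigma> e s q \<noteq> None" if st: "(e, s, q) \<in> stencil S \<sigma>" for e s q
  proof (cases "cell_at S \<sigma> e s")
    case None
    with bd nodes st show ?thesis
      by (auto simp: dir_deriv_def boundary_data_supplied_def)
  next
    case (Some K)
    then have K: "K \<in> cells S" "coord \<sigma> \<in> closure K"
      using stencil_cell[OF mesh nodes orient st] by auto
    note KD = open_convex_polygonD[OF conforming_meshD(2)[OF mesh K(1)]]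
    have "cell_fun S K differentiable_on closure K"
      using rec K(1) by (auto simp: valid_reconstruction_def)
    then have "rel_deriv (closure K) (cell_fun S K) (coord \<sigma>) \<noteq> None"
      using KD K(2) by (intro rel_deriv_convex_body) auto
    moreover obtain P where "rel_deriv G (fwd S) (pt_state S \<sigma>) = Some P"
      using adm state rel_deriv_open[OF \<open>open G\<close> state] unfolding admissibility_transform_def by blast
    ultimately show ?thesis
      using Some dom by (auto simp: dir_deriv_def)
  qed
  show "edge_weight S \<sigma> e \<noteq> None" if "\<sigma> = Vertex v" for v e
  proof -
    have "v \<in> mesh_vertices (cells S)"
      using nodes that unfolding valid_nodes_def by blast
    moreover have "unit_tangent_from v f (tangent S (Vertex v) f)" if "f \<in> edges_at S (Vertex v)" for f
      using orient nodes that \<open>\<sigma> = Vertex v\<close> by (fastforce simp: valid_orientation_def)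
    ultimately show ?thesis
      using edge_weight_defined[OF mesh] that by simp
  qed
  show "finite (edges_at S \<sigma>)"
    using finite_mesh_edges[OF mesh] by (auto simp: edges_at_def)
qed

section \<open>The point stage\<close>

theorem proposition3p5:
  fixes S :: "('m::finite) scheme"
    and \<Omega> :: "(real^2) set"
    and G Gpt :: "(real^'m) set"
    and \<B> :: "real^'m \<Rightarrow> real^'m"
    and w :: "node \<Rightarrow> real^'m"
    and \<Delta>t :: real
  assumes "open G" and "hyperbolic_on G (flux S)"
    and "conforming_mesh \<Omega> (cells S)"
    and "valid_nodes S"
    and "valid_reconstruction S"
    and "valid_orientation S"
    and "valid_speeds S"
    and "exact_setting S G \<B> Gpt w \<or> practical_setting S \<B> Gpt \<Delta>t w"
  shows "(exact_setting S G \<B> Gpt w \<longrightarrow> (\<forall>\<sigma>\<in>nodes S. \<exists>d. point_op S \<sigma> = Some d)) \<and>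
    (\<forall>\<sigma>\<in>nodes S. \<exists>w' u'. w_next S \<Delta>t w \<sigma> = Some w' \<and> u_next S \<B> \<Delta>t w \<sigma> = Some u' \<and> u' \<in> Gpt)"
proof -
  have op: "\<exists>d. point_op S \<sigma> = Some d" if "exact_setting S G \<B> Gpt w" "\<sigma> \<in> nodes S" for \<sigma>
    using exact_point_op_defined[OF assms(1-4) that(2) assms(5,6) that(1)] by blast
  have range: "range \<B> \<subseteq> Gpt"
    using assms(8)
  proof
    assume "exact_setting S G \<B> Gpt w"
    then have "bij_betw (fwd S) G UNIV" "\<B> = inv_into G (fwd S)" "Gpt = G"
      by (auto simp: exact_setting_def admissibility_transform_def)
    then show ?thesis
      by (auto simp: bij_betw_def intro: inv_into_into)
  qed (auto simp: practical_setting_def)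
  have "w_next S \<Delta>t w \<sigma> \<noteq> None" if "\<sigma> \<in> nodes S" for \<sigma>
    using assms(8)
  proof
    assume "exact_setting S G \<B> Gpt w"
    with op that show ?thesis by (fastforce simp: w_next_def)
  qed (use that in \<open>auto simp: practical_setting_def\<close>)
  with op range show ?thesis
    by (fastforce simp: u_next_def)
qed

end
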